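(* Let $p$ be a prime, $l,n\in\mathbb N$, $r\in\mathbb Z$ and $s,t\in\{0,\ldots,p-1\}$. If $p\mid n$, or $p-1\nmid n-l-1$, or $s=p-1$, or ($s=2t$ and $p\neq 2$), then $$\left\{\begin{matrix} pn+s\\ pr+t\end{matrix}\right\}_{l,p^{2}}\equiv(-1)^t\binom st\left\{\begin{matrix} n\\ r\end{matrix}\right\}_{l,p}\pmod p .$$ When $p\nmid n$, $p-1\mid n-l-1$ and $s<t\leqslant p-1$, we have $$\left\{\begin{matrix} pn+s\\ pr+t\end{matrix}\right\}_{l,p^{2}}\equiv\begin{cases}(-1)^{s+\frac{n-l-1}{p-1}}\,\dfrac nt\binom{\frac{n-l-1}{p-1}-1}{l}\Big/\binom{t-1}s \pmod p&\text{if } n>l+1,\\ 0\pmod p&\text{if } n\leqslant l+1.\end{cases}$$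
   Context: $\mathbb N=\{0,1,2,\ldots\}$. Binomial coefficients: $\binom x0=1$, $\binom xk=x(x-1)\cdots(x-k+1)/k!$ for $k\in\mathbb Z^+$ (for arbitrary rational $x$), and $\binom x{k}=0$ for negative integers $k$. For a prime $p$, $b\in\mathbb Z^+$, $l,n\in\mathbb N$ and $r\in\mathbb Z$, the normalized cyclotomic $\psi$-coefficient is $$\left\{\begin{matrix} n\\ r\end{matrix}\right\}_{l,p^{b}}:=p^{-\left\lfloor\frac{n-p^{b-1}-lp^{b}}{\phi(p^{b})}\right\rfloor}\sum_{k\equiv r\,(\mathrm{mod}\ p^{b})}(-1)^k\binom nk\binom{(k-r)/p^{b}}l,$$ where the sum is over all integers $k\equiv r \pmod{p^b}$, $\phi$ is Euler's totient function and $\lfloor\cdot\rfloor$ the floor function. These numbers are integers. Division by $t$ and $\binom{t-1}{s}$ (both prime to $p$) is understood modulo $p$. *)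

theory Defs
  imports Complex_Main "HOL-Number_Theory.Number_Theory"
begin

text \<open>
  The sum over all integers \<open>k\<close> congruent to \<open>r\<close> modulo \<open>p ^ b\<close> is restricted to \<open>0 \<le> k \<le> n\<close>,
  since the binomial coefficient of \<open>n\<close> over \<open>k\<close> vanishes for all other \<open>k\<close>. The upper argument
  \<open>(k - r) / p ^ b\<close> of the second binomial coefficient is an integer which may be negative,
  and the exponent of \<open>p\<close> may have either sign, so the coefficient is defined as a rational number.
\<close>

definition psi_coeff :: "nat \<Rightarrow> nat \<Rightarrow> nat \<Rightarrow> nat \<Rightarrow> int \<Rightarrow> rat" where
  "psi_coeff p b l n r =
     of_nat p powi
       (- \<lfloor>(of_nat n - of_nat p ^ (b - 1) - of_nat l * of_nat p ^ b) / (of_nat (totient (p ^ b)) :: rat)\<rfloor>)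
     * (\<Sum>k | k \<le> n \<and> [int k = r] (mod int p ^ b).
          (- 1) ^ k * of_nat (n choose k) * ((of_int (int k - r) / of_nat p ^ b) gchoose l))"

text \<open>
  Congruence modulo a prime \<open>p\<close> between \<open>p\<close>-integral rationals, i.e. in the integers localized
  at \<open>p\<close>. On integers it is the usual congruence, and dividing by an integer prime to \<open>p\<close>
  amounts to multiplying by its inverse modulo \<open>p\<close>. Both sides are required to be
  \<open>p\<close>-integral; for \<^const>\<open>psi_coeff\<close>, an integer times a power of \<open>p\<close>, this means being an integer.
\<close>

definition p_integral :: "nat \<Rightarrow> rat \<Rightarrow> bool" where
  "p_integral p x \<longleftrightarrow> (\<exists>a b :: int. \<not> int p dvd b \<and> x = of_int a / of_int b)"

definition p_cong :: "nat \<Rightarrow> rat \<Rightarrow> rat \<Rightarrow> bool" where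
  "p_cong p x y \<longleftrightarrow>
     p_integral p x \<and> p_integral p y \<and> (\<exists>z. p_integral p z \<and> x - y = of_nat p * z)"

end

theory Submission
  imports Defs "HOL-Computational_Algebra.Polynomial"
begin

text \<open>
  Write \<open>v = 1 - x\<close> and \<open>W = 1 - x ^ p\<close>. Then \<open>v ^ p = W + p * g\<close> with \<open>g\<close> divisible by \<open>v\<close>, so
  \<open>v ^ (p * n + s) = v ^ s * (W + p * g) ^ n\<close>. Applying the linear functional that picks out the
  coefficient, the zeroth order term \<open>v ^ s * W ^ n\<close> contributes
  \<open>(-1) ^ t * (s choose t)\<close> times the coefficient modulo \<open>p\<close>, and terms of order at least two vanish
  to the required accuracy by the divisibility \<open>residue_sum_dvd\<close> of Fleck, Weisman and Wan.
  The first order term \<open>n * p * g * v ^ s * W ^ (n - 1)\<close> can only matter if \<open>p - 1\<close> divides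
  \<open>n - l - 1\<close>. In that case \<open>residue_sum_cong\<close> evaluates it as the Fleck quotient, which is
  \<open>\<plusminus> ((n - l - 1) / (p - 1) - 1 choose l)\<close> independently of the residue class, times the sum of
  the coefficients of \<open>g * v ^ s\<close> at exponents congruent to \<open>t\<close> modulo \<open>p\<close>. Multiplied by \<open>p\<close>, this sum is
  the alternating sum of the \<open>(p + s choose k)\<close> with \<open>k\<close> congruent to \<open>t\<close>: it vanishes by reflection if
  \<open>s = 2 * t\<close>, and reduces to the single term \<open>k = t\<close> if \<open>s < t\<close>.
\<close>

section \<open>Binomial weights and the residue functional\<close>

text \<open>
  The library restricts \<^const>\<open>gbinomial\<close> to fields of characteristic zero when terms are
  parsed, so integer-valued generalized binomial coefficients are spelled out.
\<close>

definition int_gbinomial :: "int \<Rightarrow> nat \<Rightarrow> int" where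
  "int_gbinomial a k = pochhammer (a - int k + 1) k div fact k"

lemma int_gbinomial_0 [simp]: "int_gbinomial a 0 = 1"
  by (simp add: int_gbinomial_def)

lemma int_gbinomial_Suc_Suc:
  "int_gbinomial (a + 1) (Suc k) = int_gbinomial a k + int_gbinomial a (Suc k)"
  unfolding int_gbinomial_def gbinomial_int_pochhammer'[symmetric] by (rule gbinomial_int_Suc_Suc)

lemma of_int_int_gbinomial: "of_int (int_gbinomial a k) = (of_int a :: 'a :: field_char_0) gchoose k"
  unfolding int_gbinomial_def gbinomial_int_pochhammer'[symmetric] by (rule of_int_gbinomial)

text \<open>Extension by zero lets a sum over one residue class run over all exponents of a
  polynomial.\<close>

definition residue_binomial :: "nat \<Rightarrow> nat \<Rightarrow> int \<Rightarrow> int" where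
  "residue_binomial q l d = (if int q dvd d then int_gbinomial (d div int q) l else 0)"

lemma residue_binomial_0: "residue_binomial q 0 d = (if int q dvd d then 1 else 0)"
  by (simp add: residue_binomial_def)

text \<open>
  Up to the power of \<open>p\<close>, the \<open>\<psi>\<close>-coefficient is the value of this functional at
  \<open>(1 - x) ^ n\<close>. Writing \<open>f\<close> as a sum of \<open>x ^ i * f\<^sub>i (y)\<close> with \<open>y = x ^ q\<close> and \<open>0 \<le> i < q\<close>, its
  value for \<open>0 \<le> R < q\<close> is the coefficient of \<open>(y - 1) ^ l\<close> in \<open>f\<^sub>R\<close>.
\<close>

definition residue_sum :: "nat \<Rightarrow> nat \<Rightarrow> int \<Rightarrow> int poly \<Rightarrow> int" where
  "residue_sum q l R f = (\<Sum>k\<le>degree f. coeff f k * residue_binomial q l (int k - R))"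

section \<open>Linearity and shift rules of the functional\<close>

text \<open>Adding \<open>q\<close> to \<open>d\<close> raises the upper argument
  \<open>d div q\<close> by one, so this is Pascal's rule.\<close>

lemma residue_binomial_shift:
  assumes "q > 0"
  shows "residue_binomial q (Suc l) (d + int q) = residue_binomial q (Suc l) d + residue_binomial q l d"
    and "residue_binomial q 0 (d + int q) = residue_binomial q 0 d"
  using assms by (simp_all add: residue_binomial_def int_gbinomial_Suc_Suc)

lemma residue_sum_altdef:
  assumes "degree f \<le> N"
  shows "residue_sum q l R f = (\<Sum>k\<le>N. coeff f k * residue_binomial q l (int k - R))"
  unfolding residue_sum_def using assms
  by (intro sum.mono_neutral_left) (auto simp: coeff_eq_0)

lemma residue_sum_0 [simp]: "residue_sum q l R 0 = 0"
  by (simp add: residue_sum_def)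

lemma residue_sum_add: "residue_sum q l R (f + g) = residue_sum q l R f + residue_sum q l R g"
proof -
  define N where "N = max (degree f) (degree g)"
  have "degree (f + g) \<le> N" "degree f \<le> N" "degree g \<le> N"
    by (auto simp: N_def degree_add_le)
  thus ?thesis
    by (simp add: residue_sum_altdef[of _ N] sum.distrib algebra_simps)
qed

lemma residue_sum_smult: "residue_sum q l R (smult c f) = c * residue_sum q l R f"
  by (simp add: residue_sum_altdef[of _ "degree f"] degree_smult_le sum_distrib_left mult.assoc)

lemma residue_sum_of_nat_mult:
  "residue_sum q l R (of_nat c * f) = int c * residue_sum q l R f"
  using residue_sum_smult[of q l R "int c" f] by (simp add: of_nat_poly)

lemma residue_sum_minus: "residue_sum q l R (- f) = - residue_sum q l R f"
  using residue_sum_smult[of q l R "-1" f] by simp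

lemma residue_sum_diff: "residue_sum q l R (f - g) = residue_sum q l R f - residue_sum q l R g"
  using residue_sum_add[of q l R f "-g"] by (simp add: residue_sum_minus)

lemma residue_sum_sum: "residue_sum q l R (\<Sum>i\<in>A. f i) = (\<Sum>i\<in>A. residue_sum q l R (f i))"
  by (induction A rule: infinite_finite_induct) (simp_all add: residue_sum_add)

lemma residue_sum_monom: "residue_sum q l R (monom c k) = c * residue_binomial q l (int k - R)"
proof -
  have "residue_sum q l R (monom c k) =
      (\<Sum>i\<le>k. if i = k then c * residue_binomial q l (int k - R) else 0)"
    by (subst residue_sum_altdef[OF degree_monom_le], intro sum.cong) auto
  thus ?thesis by simp
qed

lemma residue_sum_expand:
  assumes "f = (\<Sum>i\<in>A. monom (c i) (e i))"
  shows "residue_sum q l R f = (\<Sum>i\<in>A. c i * residue_binomial q l (int (e i) - R))"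
  by (simp add: assms residue_sum_sum residue_sum_monom)

lemma residue_sum_monom_mult:
  "residue_sum q l R (monom 1 i * f) = residue_sum q l (R - int i) f"
proof -
  have "monom 1 i * f = (\<Sum>k\<le>degree f. monom (coeff f k) (i + k))"
    by (subst poly_as_sum_of_monoms[of f, symmetric])
       (simp add: sum_distrib_left mult_monom)
  hence "residue_sum q l R (monom 1 i * f) =
      (\<Sum>k\<le>degree f. coeff f k * residue_binomial q l (int (i + k) - R))"
    by (rule residue_sum_expand)
  thus ?thesis by (simp add: residue_sum_def algebra_simps)
qed

lemma residue_sum_shift:
  assumes "q > 0"
  shows "residue_sum q (Suc l) (R - int q) f = residue_sum q (Suc l) R f + residue_sum q l R f"
    and "residue_sum q 0 (R - int q) f = residue_sum q 0 R f"
proof -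
  have "int k - (R - int q) = (int k - R) + int q" for k by simp
  thus "residue_sum q (Suc l) (R - int q) f = residue_sum q (Suc l) R f + residue_sum q l R f"
    and "residue_sum q 0 (R - int q) f = residue_sum q 0 R f"
    by (simp_all only: residue_sum_def residue_binomial_shift[OF assms] distrib_left sum.distrib)
qed

text \<open>Up to sign, the functional reads off the coefficient of \<open>(y - 1) ^ l\<close>, so a
  factor \<open>1 - y\<close> lowers \<open>l\<close> by one and annihilates the case
  \<open>l = 0\<close>. The inductions on \<open>k + l\<close> below remove factors in this
  way.\<close>

lemma residue_sum_difference_mult:
  assumes "q > 0"
  shows "residue_sum q (Suc l) R ((1 - monom 1 q) * f) = - residue_sum q l R f"
    and "residue_sum q 0 R ((1 - monom 1 q) * f) = 0"
  using assms
  by (simp_all add: left_diff_distrib residue_sum_diff residue_sum_monom_mult residue_sum_shift)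

section \<open>Powers of \<open>1 - x ^ m\<close>, in particular \<open>p\<close>-th powers\<close>

lemma one_minus_monom_power:
  "(1 - monom 1 m :: int poly) ^ N = (\<Sum>k\<le>N. monom ((-1) ^ k * int (N choose k)) (k * m))"
proof -
  have "(1 - monom 1 m :: int poly) ^ N = (monom (-1) m + 1) ^ N"
    by (simp add: minus_monom[symmetric])
  also have "\<dots> = (\<Sum>k\<le>N. monom ((-1) ^ k * int (N choose k)) (k * m))"
    unfolding binomial_ring
    by (intro sum.cong) (auto simp: monom_power of_nat_monom mult_monom mult.commute)
  finally show ?thesis .
qed

lemma residue_sum_binomial_power:
  "residue_sum q l R ((1 - monom 1 m) ^ N) =
     (\<Sum>k\<le>N. (-1) ^ k * int (N choose k) * residue_binomial q l (int (k * m) - R))"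
  by (rule residue_sum_expand) (rule one_minus_monom_power)

lemma prime_dvd_choose:
  assumes "prime p" "0 < i" "i < p"
  shows "p dvd (p choose i)"
proof -
  have "i * (p choose i) = p * (p - 1 choose (i - 1))"
    using assms by (simp add: times_binomial_minus1_eq)
  hence "p dvd i * (p choose i)" by simp
  thus ?thesis using assms by (auto simp: prime_dvd_mult_iff dvd_imp_le)
qed

text \<open>Expand \<open>u ^ p = (1 - w) ^ p\<close> with \<open>w = 1 - u\<close>. The middle
  binomial coefficients are multiples of \<open>p\<close>; the linear term is exactly
  \<open>- p * w\<close>, recorded by the \<open>- 1\<close>, and the remaining middle terms contain
  \<open>w ^ 2\<close>. For \<open>p = 2\<close> the top term \<open>(- w) ^ p\<close> has the
  opposite sign, so \<open>h = 1\<close> is checked directly.\<close>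

lemma one_minus_power_prime:
  fixes u :: "'a :: comm_ring_1"
  assumes "prime p"
  obtains h where "(1 - u) ^ p = 1 - u ^ p + of_nat p * ((1 - u) * ((1 - u) * h - 1))"
proof (cases "p = 2")
  case True
  have "(1 - u) ^ p = 1 - u ^ p + of_nat p * ((1 - u) * ((1 - u) * 1 - 1))"
    unfolding True by (simp add: power2_eq_square algebra_simps)
  thus ?thesis by (rule that)
next
  case False
  with assms have p: "p \<ge> 3" "odd p"
    using prime_ge_2_nat[of p] primes_dvd_imp_eq[of 2 p] by fastforce+
  define w where "w = 1 - u"
  define D where "D = (\<Sum>i\<in>{2..<p}. of_nat ((p choose i) div p) * (-1) ^ i * w ^ (i - 2))"
  have split: "{..p} = insert 0 (insert 1 (insert p {2..<p}))"
    using p by auto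
  have "u ^ p = (- w + 1) ^ p" by (simp add: w_def)
  also have "\<dots> = (\<Sum>i\<le>p. of_nat (p choose i) * (- w) ^ i)"
    by (subst binomial_ring) simp
  also have "\<dots> = 1 - of_nat p * w - w ^ p + (\<Sum>i\<in>{2..<p}. of_nat (p choose i) * (- w) ^ i)"
    unfolding split using p by (simp add: algebra_simps)
  also have "(\<Sum>i\<in>{2..<p}. of_nat (p choose i) * (- w) ^ i) = of_nat p * (w * (w * D))"
    unfolding D_def sum_distrib_left
  proof (intro sum.cong refl)
    fix i assume i: "i \<in> {2..<p}"
    have "of_nat (p choose i) = of_nat p * (of_nat ((p choose i) div p) :: 'a)"
      using prime_dvd_choose[OF assms, of i] i
      by (metis atLeastLessThan_iff dvd_mult_div_cancel of_nat_mult pos2 order_less_le_trans)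
    moreover have "(- w) ^ i = (-1) ^ i * (w * (w * w ^ (i - 2)))"
      using i by (subst power_minus) (simp flip: power_Suc add: Suc_diff_Suc numeral_2_eq_2)
    ultimately show "of_nat (p choose i) * (- w) ^ i =
        of_nat p * (w * (w * (of_nat ((p choose i) div p) * (-1) ^ i * w ^ (i - 2))))"
      by (simp only: ac_simps)
  qed
  finally have "w ^ p = 1 - u ^ p + of_nat p * (w * (w * D - 1))"
    by (simp add: algebra_simps)
  thus ?thesis unfolding w_def by (rule that)
qed

lemma one_minus_monom_power_prime:
  assumes "prime p"
  obtains h :: "int poly" where
    "(1 - monom 1 q) ^ p = (1 - monom 1 (p * q)) +
       of_nat p * ((1 - monom 1 q) * ((1 - monom 1 q) * h - 1))"
  using one_minus_power_prime[OF assms, of "monom 1 q :: int poly"]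
  by (metis monom_power mult.commute power_one)

section \<open>Divisibility of Fleck, Weisman and Wan\<close>

text \<open>The bound equals \<open>k * (p - 1) + l * p + 1\<close>: with
  \<open>W = 1 - x ^ q\<close>, gaining a factor \<open>p\<close> costs \<open>p - 1\<close> factors
  \<open>W\<close>, lowering \<open>l\<close> by one costs \<open>p\<close> of them, and one is kept
  in reserve. The cofactor \<open>f\<close> is arbitrary so that it can absorb
  \<open>W * h - 1\<close>.\<close>

lemma residue_sum_dvd:
  assumes p: "prime p" and q: "q > 0" and N: "(k + l) * (p - 1) + l + 1 \<le> N"
  shows "int p ^ k dvd residue_sum (p * q) l R ((1 - monom 1 q) ^ N * f)"
  using N
proof (induction "k + l" arbitrary: k l N f)
  case 0
  thus ?case by simp
next
  case (Suc j)
  have p2: "p \<ge> 2" using p by (rule prime_ge_2_nat)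
  define W where "W = (1 - monom 1 q :: int poly)"
  have pq: "p * q > 0" using p2 q by simp
  show ?case
  proof (cases k)
    case 0
    thus ?thesis by simp
  next
    case (Suc k')
    have kl: "k + l = Suc j" using Suc.hyps by simp
    have N': "j * (p - 1) + (p - 1) + l + 1 \<le> N"
      using Suc.prems kl by simp
    hence Np: "p \<le> N" using p2 by simp
    obtain h where h: "W ^ p = (1 - monom 1 (p * q)) + of_nat p * (W * (W * h - 1))"
      unfolding W_def by (rule one_minus_monom_power_prime[OF p])
    have WN: "W ^ N = W ^ p * W ^ (N - p)"
      using Np by (simp flip: power_add)
    \<comment> \<open>Trading \<open>W ^ p\<close> for \<open>1 - x ^ (p * q)\<close> lowers \<open>l\<close>, trading it for \<open>p * W\<close> lowers \<open>k\<close>.\<close>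
    have "W ^ N * f = (1 - monom 1 (p * q)) * (W ^ (N - p) * f) +
        of_nat p * (W ^ (N - p + 1) * ((W * h - 1) * f))"
      unfolding WN h by (simp add: algebra_simps)
    hence eq: "residue_sum (p * q) l R (W ^ N * f) =
        residue_sum (p * q) l R ((1 - monom 1 (p * q)) * (W ^ (N - p) * f)) +
        int p * residue_sum (p * q) l R (W ^ (N - p + 1) * ((W * h - 1) * f))"
      by (simp only: residue_sum_add residue_sum_of_nat_mult)
    have "int p ^ k' dvd residue_sum (p * q) l R (W ^ (N - p + 1) * ((W * h - 1) * f))"
      unfolding W_def
    proof (rule Suc.hyps(1))
      show "j = k' + l" using kl Suc by simp
      show "(k' + l) * (p - 1) + l + 1 \<le> N - p + 1"
        using N' kl Suc p2 by auto
    qed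
    hence "int p ^ k dvd int p * residue_sum (p * q) l R (W ^ (N - p + 1) * ((W * h - 1) * f))"
      unfolding Suc by simp
    moreover have "int p ^ k dvd residue_sum (p * q) l R ((1 - monom 1 (p * q)) * (W ^ (N - p) * f))"
    proof (cases l)
      case 0
      thus ?thesis using residue_sum_difference_mult(2)[OF pq] by simp
    next
      case l: (Suc l')
      have "int p ^ k dvd residue_sum (p * q) l' R (W ^ (N - p) * f)"
        unfolding W_def
      proof (rule Suc.hyps(1))
        show j: "j = k + l'" using kl l by simp
        show "(k + l') * (p - 1) + l' + 1 \<le> N - p"
          using N' l p2 unfolding j by auto
      qed
      thus ?thesis using residue_sum_difference_mult(1)[OF pq] l by simp
    qed
    ultimately show ?thesis unfolding W_def[symmetric] eq by (rule dvd_add[rotated])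
  qed
qed

section \<open>The leading value modulo the next power of \<open>p\<close>\<close>

text \<open>A residue class modulo \<open>q\<close> is the disjoint union of \<open>p\<close>
  classes modulo \<open>p * q\<close>: if \<open>d = q * e\<close>, only the residue of
  \<open>- e\<close> modulo \<open>p\<close> qualifies as \<open>i\<close>.\<close>

lemma sum_residue_binomial_refine:
  assumes "p > 0" "q > 0"
  shows "(\<Sum>i<p. residue_binomial (p * q) 0 (d + int (q * i))) = residue_binomial q 0 d"
proof (cases "int q dvd d")
  case False
  moreover have "\<not> int (p * q) dvd d + int (q * i)" for i
    using False by (metis dvd_add_left_iff dvd_mult_right dvd_triv_left of_nat_mult)
  ultimately show ?thesis by (simp add: residue_binomial_def del: of_nat_mult)
next
  case True
  then obtain e where e: "d = int q * e" by blast
  have *: "int (p * q) dvd d + int (q * i) \<longleftrightarrow> i = nat ((- e) mod int p)" if "i < p" for i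
  proof -
    have "int (p * q) dvd d + int (q * i) \<longleftrightarrow> int q * int p dvd int q * (e + int i)"
      by (simp add: e algebra_simps)
    also have "\<dots> \<longleftrightarrow> int p dvd e + int i"
      using assms by simp
    also have "\<dots> \<longleftrightarrow> int p dvd int i - (- e)"
      by (simp add: add.commute)
    also have "\<dots> \<longleftrightarrow> int i mod int p = (- e) mod int p"
      by (rule mod_eq_dvd_iff[symmetric])
    also have "\<dots> \<longleftrightarrow> i = nat ((- e) mod int p)"
      using that assms by auto
    finally show ?thesis .
  qed
  have "nat ((- e) mod int p) < p"
    using assms by (simp add: nat_less_iff)
  moreover have "(\<Sum>i<p. residue_binomial (p * q) 0 (d + int (q * i))) =
      (\<Sum>i<p. if i = nat ((- e) mod int p) then 1 else 0)"
    using * by (intro sum.cong refl) (auto simp: residue_binomial_def simp del: of_nat_mult)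
  ultimately show ?thesis using True by (simp add: residue_binomial_def)
qed

lemma residue_sum_refine:
  assumes "p > 0" "q > 0"
  shows "(\<Sum>i<p. residue_sum (p * q) 0 (R - int (q * i)) f) = residue_sum q 0 R f"
proof -
  have "(\<Sum>i<p. residue_sum (p * q) 0 (R - int (q * i)) f) =
      (\<Sum>k\<le>degree f. coeff f k * (\<Sum>i<p. residue_binomial (p * q) 0 ((int k - R) + int (q * i))))"
    unfolding residue_sum_def sum_distrib_left
    by (subst sum.swap) (simp add: algebra_simps)
  thus ?thesis
    by (simp add: sum_residue_binomial_refine[OF assms] residue_sum_def del: of_nat_mult)
qed

text \<open>Cancelling one factor \<open>W = 1 - x ^ q\<close> in the expansion of
  \<open>W ^ p\<close> shows that \<open>W ^ (p - 1)\<close> is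
  \<open>1 + x ^ q + ... + x ^ (q * (p - 1))\<close> modulo \<open>p\<close>. This sum merges
  \<open>p\<close> classes modulo \<open>p * q\<close> into one modulo \<open>q\<close>.\<close>

lemma residue_sum_power_pred_prime:
  assumes p: "prime p" and q: "q > 0"
  shows "[residue_sum (p * q) 0 R ((1 - monom 1 q) ^ (p - 1) * f) = residue_sum q 0 R f] (mod int p)"
proof -
  define W where "W = (1 - monom 1 q :: int poly)"
  have W0: "W \<noteq> 0"
  proof
    assume "W = 0"
    hence "coeff W q = 0" by simp
    thus False using q by (simp add: W_def)
  qed
  have p0: "p > 0" using p by (rule prime_gt_0_nat)
  obtain h where h: "W ^ p = (1 - monom 1 (p * q)) + of_nat p * (W * (W * h - 1))"
    unfolding W_def by (rule one_minus_monom_power_prime[OF p])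
  have "W * (\<Sum>i<p. monom 1 q ^ i) = 1 - monom 1 q ^ p"
    unfolding W_def by (rule one_diff_power_eq[symmetric])
  hence "W * (W ^ (p - 1) - ((\<Sum>i<p. monom 1 q ^ i) + of_nat p * (W * h - 1))) = 0"
    using h p0 by (simp add: algebra_simps monom_power flip: power_Suc)
  hence Wp: "W ^ (p - 1) = (\<Sum>i<p. monom 1 (q * i)) + of_nat p * (W * h - 1)"
    using W0 by (simp add: monom_power)
  have "W ^ (p - 1) * f = (\<Sum>i<p. monom 1 (q * i) * f) + of_nat p * ((W * h - 1) * f)"
    unfolding Wp by (simp add: algebra_simps sum_distrib_left)
  hence "residue_sum (p * q) 0 R (W ^ (p - 1) * f) =
      residue_sum q 0 R f + int p * residue_sum (p * q) 0 R ((W * h - 1) * f)"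
    by (simp only: residue_sum_add residue_sum_sum residue_sum_of_nat_mult residue_sum_monom_mult
        residue_sum_refine[OF p0 q])
  thus ?thesis by (simp add: W_def cong_iff_dvd_diff)
qed

text \<open>The exponent is one below the bound at which \<open>residue_sum_dvd\<close> yields
  \<open>p ^ (k + 1)\<close>. The exchange for \<open>W ^ p\<close> is the same, but leading terms
  are tracked: \<open>1 - x ^ (p * q)\<close> leads to the pair \<open>(l - 1, k)\<close> and
  \<open>- p * W\<close> to \<open>(l, k - 1)\<close>, each with a minus sign, so Pascal's rule
  builds up the binomial coefficient.\<close>

lemma residue_sum_cong:
  assumes p: "prime p" and q: "q > 0"
  shows "[residue_sum (p * q) l R ((1 - monom 1 q) ^ (l + (l + k + 1) * (p - 1)) * f) =
     (-1) ^ (l + k) * int (l + k choose l) * int p ^ k * residue_sum q 0 R f] (mod int p ^ (k + 1))"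
proof (induction "l + k" arbitrary: l k)
  case 0
  thus ?case using residue_sum_power_pred_prime[OF p q, of R f] by simp
next
  case (Suc j)
  have p2: "p \<ge> 2" using p by (rule prime_ge_2_nat)
  have pq: "p * q > 0" using p2 q by simp
  define W where "W = (1 - monom 1 q :: int poly)"
  define N where "N = l + (l + k + 1) * (p - 1)"
  define c where "c = residue_sum q 0 R f"
  have lk: "l + k = Suc j" using Suc.hyps by simp
  have N: "N = l + j * (p - 1) + (p - 1) + (p - 1)"
    by (simp add: N_def lk)
  hence Np: "N \<ge> p"
    using p2 lk by (cases j) (auto simp: algebra_simps)
  obtain h where h: "W ^ p = (1 - monom 1 (p * q)) + of_nat p * (W * (W * h - 1))"
    unfolding W_def by (rule one_minus_monom_power_prime[OF p])
  have WN: "W ^ N = W ^ p * W ^ (N - p)"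
    using Np by (simp flip: power_add)
  have "W ^ N * f = (1 - monom 1 (p * q)) * (W ^ (N - p) * f) -
      of_nat p * (W ^ (N - p + 1) * f) + of_nat p * (W ^ (N - p + 2) * (h * f))"
    unfolding WN h by (simp add: algebra_simps power2_eq_square)
  hence eq: "residue_sum (p * q) l R (W ^ N * f) =
      residue_sum (p * q) l R ((1 - monom 1 (p * q)) * (W ^ (N - p) * f)) -
      int p * residue_sum (p * q) l R (W ^ (N - p + 1) * f) +
      int p * residue_sum (p * q) l R (W ^ (N - p + 2) * (h * f))"
    by (simp only: residue_sum_add residue_sum_diff residue_sum_of_nat_mult)
  \<comment> \<open>The quadratic part of the exchange has one more factor \<open>W\<close>, just
    enough for \<open>residue_sum_dvd\<close>.\<close>
  have 3: "[int p * residue_sum (p * q) l R (W ^ (N - p + 2) * (h * f)) = 0] (mod int p ^ (k + 1))"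
  proof -
    have "int p ^ k dvd residue_sum (p * q) l R (W ^ (N - p + 2) * (h * f))"
      unfolding W_def
      by (rule residue_sum_dvd[OF p q]) (use N lk p2 in \<open>simp add: add.commute[of k l]\<close>)
    thus ?thesis by (simp add: cong_0_iff)
  qed
  have 2: "[int p * residue_sum (p * q) l R (W ^ (N - p + 1) * f) =
      (-1) ^ j * int (j choose l) * int p ^ k * c] (mod int p ^ (k + 1))"
  proof (cases k)
    case 0
    hence "j choose l = 0" using lk by simp
    thus ?thesis using 0 by (simp add: cong_0_iff del: binomial_eq_0_iff)
  next
    case (Suc k')
    have j: "j = l + k'" using lk Suc by simp
    have "N - p + 1 = l + (l + k' + 1) * (p - 1)"
      using N p2 unfolding j by simp
    hence "[residue_sum (p * q) l R (W ^ (N - p + 1) * f) =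
        (-1) ^ (l + k') * int (l + k' choose l) * int p ^ k' * c] (mod int p ^ (k' + 1))"
      using Suc.hyps(1)[OF j] by (simp add: W_def c_def)
    hence "[int p * residue_sum (p * q) l R (W ^ (N - p + 1) * f) =
        int p * ((-1) ^ (l + k') * int (l + k' choose l) * int p ^ k' * c)] (mod int p * int p ^ (k' + 1))"
      by (rule cong_cmult_leftI)
    thus ?thesis by (simp add: Suc j algebra_simps)
  qed
  \<comment> \<open>The difference stands for \<open>j choose (l - 1)\<close>, read as 0 if
    \<open>l = 0\<close>, where truncated subtraction would give 1.\<close>
  have 1: "[residue_sum (p * q) l R ((1 - monom 1 (p * q)) * (W ^ (N - p) * f)) =
      - ((-1) ^ j * int ((Suc j choose l) - (j choose l)) * int p ^ k * c)] (mod int p ^ (k + 1))"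
  proof (cases l)
    case 0
    thus ?thesis using residue_sum_difference_mult(2)[OF pq] by simp
  next
    case (Suc l')
    have j: "j = l' + k" using lk Suc by simp
    have "N - p = l' + (l' + k + 1) * (p - 1)"
      using N p2 Suc unfolding j by simp
    hence "[residue_sum (p * q) l' R (W ^ (N - p) * f) =
        (-1) ^ j * int (j choose l') * int p ^ k * c] (mod int p ^ (k + 1))"
      using Suc.hyps(1)[OF j] by (simp add: W_def c_def j)
    thus ?thesis
      using residue_sum_difference_mult(1)[OF pq] Suc by (simp add: cong_minus_minus_iff)
  qed
  have "j choose l \<le> Suc j choose l" by (cases l) auto
  hence "- ((-1) ^ j * int ((Suc j choose l) - (j choose l)) * int p ^ k * c) -
      (-1) ^ j * int (j choose l) * int p ^ k * c + 0 =
      (-1) ^ (l + k) * int (l + k choose l) * int p ^ k * c"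
    unfolding lk by (simp add: of_nat_diff algebra_simps del: binomial_Suc_Suc)
  moreover have "[residue_sum (p * q) l R (W ^ N * f) =
      - ((-1) ^ j * int ((Suc j choose l) - (j choose l)) * int p ^ k * c) -
      (-1) ^ j * int (j choose l) * int p ^ k * c + 0] (mod int p ^ (k + 1))"
    unfolding eq by (intro cong_add cong_diff 1 2 3)
  ultimately show ?case by (simp only: W_def N_def c_def)
qed

section \<open>First order expansion of \<open>(1 - x) ^ (p * n + s)\<close>\<close>

text \<open>The prefactor pays for \<open>i\<close> powers of \<open>p\<close>, and only the missing
  \<open>k - i\<close> must come from \<open>1 - x ^ q\<close>; hence the guarded premise.\<close>

lemma residue_sum_prime_power_mult_dvd:
  assumes "prime p" "q > 0" and "i < k \<Longrightarrow> (k - i + l) * (p - 1) + l + 1 \<le> N"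
  shows "int p ^ k dvd int p ^ i * residue_sum (p * q) l R ((1 - monom 1 q) ^ N * f)"
proof (cases "i < k")
  case True
  hence "int p ^ (i + (k - i)) dvd int p ^ i * residue_sum (p * q) l R ((1 - monom 1 q) ^ N * f)"
    unfolding power_add by (intro mult_dvd_mono dvd_refl residue_sum_dvd assms)
  thus ?thesis using True by simp
qed (simp add: le_imp_power_dvd dvd_mult2)

lemma binomial_expand_first_order:
  fixes a b :: "'a :: comm_ring_1"
  assumes "n > 0"
  shows "(a + b) ^ n = a ^ n + of_nat n * b * a ^ (n - 1) +
           (\<Sum>j\<in>{2..n}. of_nat (n choose j) * b ^ j * a ^ (n - j))"
proof -
  have "{..n} = insert 0 (insert 1 {2..n})" using assms by auto
  thus ?thesis
    by (subst add.commute, subst binomial_ring) (simp add: ac_simps)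
qed

text \<open>The factor \<open>p ^ j\<close> lowers the bound for the remaining power of
  \<open>1 - x ^ p\<close> by \<open>(j - 1) * (p - 1)\<close>, while \<open>j\<close> factors have
  been given up. For odd \<open>p\<close> this is a net gain or a tie, as
  \<open>(j - 1) * (p - 1) \<ge> 2 * (j - 1) \<ge> j\<close>.\<close>

lemma residue_sum_higher_term_dvd:
  assumes p: "prime p" and n: "(e + l) * (p - 1) + l + 1 \<le> n" and j: "2 \<le> j" "j \<le> n"
    and h: "(1 - monom 1 1) ^ p =
      (1 - monom 1 p) + of_nat p * ((1 - monom 1 1) * ((1 - monom 1 1) * h - 1) :: int poly)"
  shows "int p ^ (e + 1) dvd int p ^ j * residue_sum (p * p) l R
    ((1 - monom 1 p) ^ (n - j) * (((1 - monom 1 1) * ((1 - monom 1 1) * h - 1)) ^ j * f))"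
proof (cases "p = 2")
  case False
  have p0: "p > 0" using p by (rule prime_gt_0_nat)
  have p3: "p - 1 \<ge> 2" using False prime_ge_2_nat[OF p] by simp
  show ?thesis
  proof (rule residue_sum_prime_power_mult_dvd[OF p p0])
    assume "j < e + 1"
    define k where "k = e + 1 - j"
    obtain i where i: "j = i + 2" using j by (metis le_add_diff_inverse2)
    have "e = k + (i + 1)" using \<open>j < e + 1\<close> by (simp add: k_def i)
    hence eq: "(e + l) * (p - 1) = (k + l) * (p - 1) + (i + 1) * (p - 1)"
      by (simp only: distrib_right[symmetric]) (simp add: ac_simps)
    have ge: "(i + 1) * 2 \<le> (i + 1) * (p - 1)"
      using p3 by (rule mult_le_mono2)
    have "A + l + 1 \<le> n - j" if "C = A + B" "(i + 1) * 2 \<le> B" "C + l + 1 \<le> n" for A B C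
      using i that by simp
    from this[OF eq ge n] show "(e + 1 - j + l) * (p - 1) + l + 1 \<le> n - j"
      unfolding k_def[symmetric] .
  qed
next
  case True
  define v :: "int poly" where "v = 1 - monom 1 1"
  define W :: "int poly" where "W = 1 - monom 1 2"
  define g where "g = v * (v * h - 1)"
  define b where "b = g ^ (j - 2) * (v * h - 1)\<^sup>2 * f"
  have v2: "v\<^sup>2 = W + of_nat 2 * g"
    using h unfolding True v_def W_def g_def by simp
  \<comment> \<open>For \<open>p = 2\<close> a factor \<open>2 * g\<close> is no better than the \<open>W\<close> it replaces, so divisibility
    must be gained from the square of the factor \<open>v\<close> of \<open>g\<close>.\<close>
  have "g ^ j = g ^ (j - 2) * g\<^sup>2"
    using j by (simp only: power_add[symmetric] le_add_diff_inverse2)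
  moreover have "g\<^sup>2 = v\<^sup>2 * (v * h - 1)\<^sup>2"
    by (simp add: g_def power_mult_distrib)
  ultimately have gj: "g ^ j * f = v\<^sup>2 * b"
    by (simp only: b_def ac_simps)
  have "W ^ (n - j) * (g ^ j * f) = W ^ (n - j + 1) * b + of_nat 2 * (W ^ (n - j) * (g * b))"
    unfolding gj v2 by (simp add: algebra_simps)
  hence "2 ^ j * residue_sum (2 * 2) l R (W ^ (n - j) * (g ^ j * f)) =
      2 ^ j * residue_sum (2 * 2) l R (W ^ (n - j + 1) * b) +
      2 ^ (j + 1) * residue_sum (2 * 2) l R (W ^ (n - j) * (g * b))"
    by (simp only: residue_sum_add residue_sum_of_nat_mult) (simp add: distrib_left)
  moreover have "int 2 ^ (e + 1) dvd int 2 ^ j * residue_sum (2 * 2) l R (W ^ (n - j + 1) * b)"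
    unfolding W_def by (rule residue_sum_prime_power_mult_dvd) (use n j True in auto)
  moreover have "int 2 ^ (e + 1) dvd int 2 ^ (j + 1) * residue_sum (2 * 2) l R (W ^ (n - j) * (g * b))"
    unfolding W_def by (rule residue_sum_prime_power_mult_dvd) (use n j True in auto)
  ultimately show ?thesis
    unfolding True v_def[symmetric] W_def[symmetric] g_def[symmetric]
    by (simp add: dvd_add del: power_Suc)
qed

lemma residue_sum_expand_first_order:
  assumes p: "prime p" and n: "(e + l) * (p - 1) + l + 1 \<le> n"
    and h: "(1 - monom 1 1) ^ p =
      (1 - monom 1 p) + of_nat p * ((1 - monom 1 1) * ((1 - monom 1 1) * h - 1) :: int poly)"
  shows "[residue_sum (p * p) l R ((1 - monom 1 1) ^ (p * n + s)) =
      residue_sum (p * p) l R ((1 - monom 1 1) ^ s * (1 - monom 1 p) ^ n) +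
      int n * int p * residue_sum (p * p) l R ((1 - monom 1 p) ^ (n - 1) *
        ((1 - monom 1 1) * ((1 - monom 1 1) * h - 1) * (1 - monom 1 1) ^ s))] (mod int p ^ (e + 1))"
proof -
  define v :: "int poly" where "v = 1 - monom 1 1"
  define W :: "int poly" where "W = 1 - monom 1 p"
  define g where "g = v * (v * h - 1)"
  have vp: "v ^ p = W + of_nat p * g"
    using h unfolding v_def W_def g_def .
  have "v ^ (p * n + s) = v ^ s * (W + of_nat p * g) ^ n"
    by (simp only: power_add power_mult vp) (rule mult.commute)
  also have "\<dots> = v ^ s * W ^ n + of_nat (n * p) * (W ^ (n - 1) * (g * v ^ s)) +
      (\<Sum>j\<in>{2..n}. of_nat ((n choose j) * p ^ j) * (W ^ (n - j) * (g ^ j * v ^ s)))"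
    using n by (subst binomial_expand_first_order)
      (simp_all add: distrib_left sum_distrib_left power_mult_distrib ac_simps)
  finally have "residue_sum (p * p) l R (v ^ (p * n + s)) =
      residue_sum (p * p) l R (v ^ s * W ^ n) +
      int n * int p * residue_sum (p * p) l R (W ^ (n - 1) * (g * v ^ s)) +
      (\<Sum>j\<in>{2..n}. int (n choose j) * (int p ^ j *
        residue_sum (p * p) l R (W ^ (n - j) * (g ^ j * v ^ s))))"
    by (simp only: residue_sum_add residue_sum_of_nat_mult residue_sum_sum) (simp add: mult.assoc)
  moreover have "int p ^ (e + 1) dvd (\<Sum>j\<in>{2..n}. int (n choose j) * (int p ^ j *
      residue_sum (p * p) l R (W ^ (n - j) * (g ^ j * v ^ s))))"
    unfolding v_def W_def g_def
    by (intro dvd_sum dvd_mult residue_sum_higher_term_dvd[OF p n _ _ h]) auto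
  ultimately show ?thesis
    unfolding v_def[symmetric] W_def[symmetric] g_def[symmetric] by (simp add: cong_iff_dvd_diff)
qed

section \<open>The zeroth order term\<close>

text \<open>All exponents in \<open>(1 - x ^ p) ^ n\<close> are multiples of \<open>p\<close>, so of
  the monomials of \<open>(1 - x) ^ s\<close> only \<open>x ^ t\<close> reaches the class of
  \<open>p * r + t\<close>. Dividing exponents by \<open>p\<close> then turns the modulus
  \<open>p * p\<close> into \<open>p\<close>.\<close>

lemma residue_sum_main_term:
  assumes p: "p > 0" and s: "s < p" and t: "t < p"
  shows "residue_sum (p * p) l (int p * r + int t) ((1 - monom 1 1) ^ s * (1 - monom 1 p) ^ n) =
     (-1) ^ t * int (s choose t) * residue_sum p l r ((1 - monom 1 1) ^ n)"
proof -
  define W :: "int poly" where "W = 1 - monom 1 p"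
  have "residue_sum (p * p) l (int p * r + int t - int i) (W ^ n) =
      (if i = t then residue_sum p l r ((1 - monom 1 1) ^ n) else 0)" if "i \<le> s" for i
  proof (cases "i = t")
    case True
    have "residue_binomial (p * p) l (int (k * p) - int p * r) = residue_binomial p l (int k - r)" for k
    proof -
      have "int (k * p) - int p * r = int p * (int k - r)" by (simp add: algebra_simps)
      thus ?thesis using p by (simp add: residue_binomial_def)
    qed
    thus ?thesis using True by (simp add: W_def residue_sum_binomial_power del: of_nat_mult)
  next
    case False
    have "\<not> int (p * p) dvd int (k * p) - (int p * r + int t - int i)" for k
    proof
      assume "int (p * p) dvd int (k * p) - (int p * r + int t - int i)"
      hence "int p dvd int (k * p) - (int p * r + int t - int i)"
        unfolding of_nat_mult by (rule dvd_mult_left)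
      moreover have "int (k * p) - (int p * r + int t - int i) = int p * (int k - r) + (int i - int t)"
        by (simp add: algebra_simps)
      ultimately have "int p dvd int p * (int k - r) + (int i - int t)"
        by (simp only:)
      hence "int p dvd int i - int t"
        using dvd_add_right_iff[OF dvd_triv_left] by blast
      hence "int i mod int p = int t mod int p"
        by (simp only: mod_eq_dvd_iff)
      thus False using False that s t by simp
    qed
    thus ?thesis using False
      by (simp add: W_def residue_sum_binomial_power residue_binomial_def)
  qed
  note * = this
  have "(1 - monom 1 1 :: int poly) ^ s = (\<Sum>i\<le>s. smult ((-1) ^ i * int (s choose i)) (monom 1 i))"
    unfolding one_minus_monom_power by (intro sum.cong refl) (simp add: smult_monom)
  hence "(1 - monom 1 1) ^ s * W ^ n =
      (\<Sum>i\<le>s. smult ((-1) ^ i * int (s choose i)) (monom 1 i * W ^ n))"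
    by (simp add: sum_distrib_right)
  hence "residue_sum (p * p) l (int p * r + int t) ((1 - monom 1 1) ^ s * W ^ n) =
      (\<Sum>i\<le>s. (-1) ^ i * int (s choose i) * residue_sum (p * p) l (int p * r + int t - int i) (W ^ n))"
    by (simp only: residue_sum_sum residue_sum_smult residue_sum_monom_mult)
  also have "\<dots> = (\<Sum>i\<le>s. if i = t then (-1) ^ t * int (s choose t) * residue_sum p l r ((1 - monom 1 1) ^ n) else 0)"
    by (intro sum.cong refl) (simp add: *)
  finally show ?thesis by (simp add: W_def)
qed

section \<open>Coefficient sums in the first order term\<close>

text \<open>Apply the functional with \<open>l = 0\<close> to \<open>(1 - x) ^ (p + s)\<close>: the
  part with the factor \<open>1 - x ^ p\<close> is annihilated.\<close>

lemma mult_residue_sum_first_order: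
  assumes h: "(1 - monom 1 1) ^ p = (1 - monom 1 p) + of_nat p * (g :: int poly)" and p: "p > 0"
  shows "int p * residue_sum p 0 R (g * (1 - monom 1 1) ^ s) =
    (\<Sum>k\<le>p + s. (-1) ^ k * int (p + s choose k) * residue_binomial p 0 (int k - R))"
proof -
  have "(1 - monom 1 1) ^ (p + s) =
      (1 - monom 1 p) * (1 - monom 1 1) ^ s + of_nat p * (g * (1 - monom 1 1) ^ s)"
    unfolding power_add h by (simp add: algebra_simps)
  hence "residue_sum p 0 R ((1 - monom 1 1) ^ (p + s)) =
      int p * residue_sum p 0 R (g * (1 - monom 1 1) ^ s)"
    by (simp only: residue_sum_add residue_sum_of_nat_mult residue_sum_difference_mult(2)[OF p] add_0)
  thus ?thesis by (simp add: residue_sum_binomial_power)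
qed

lemma residue_sum_period: "residue_sum q 0 (int q * r + R) f = residue_sum q 0 R f"
proof -
  have "int k - (int q * r + R) = int k - R - int q * r" for k by simp
  thus ?thesis
    unfolding residue_sum_def residue_binomial_0 by (simp only: dvd_diff_left_iff dvd_triv_left)
qed

text \<open>The reflection of \<open>k\<close> to \<open>p + 2 * t - k\<close> preserves the class
  of \<open>t\<close> modulo \<open>p\<close> and the binomial coefficient, but reverses the sign
  because \<open>p\<close> is odd.\<close>

lemma residue_sum_first_order_symmetric:
  assumes h: "(1 - monom 1 1) ^ p = (1 - monom 1 p) + of_nat p * (g :: int poly)"
    and p: "odd p"
  shows "residue_sum p 0 (int t) (g * (1 - monom 1 1) ^ (2 * t)) = 0"
proof -
  have p0: "p > 0" using p by (cases p) auto
  define a where "a k = (-1) ^ k * int (p + 2 * t choose k) * residue_binomial p 0 (int k - int t)" for k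
  have "a (p + 2 * t - k) = - a k" if "k \<le> p + 2 * t" for k
  proof -
    have "int (p + 2 * t - k) - int t = int p - (int k - int t)"
      using that by simp
    hence "residue_binomial p 0 (int (p + 2 * t - k) - int t) = residue_binomial p 0 (int k - int t)"
      unfolding residue_binomial_0 by (simp only: dvd_diff_right_iff[OF dvd_refl])
    moreover have "(-1 :: int) ^ (p + 2 * t - k) = - ((-1) ^ k)"
      using that p by (simp add: minus_one_power_iff)
    moreover have "p + 2 * t choose (p + 2 * t - k) = p + 2 * t choose k"
      using that by (rule binomial_symmetric[symmetric])
    ultimately show ?thesis by (simp add: a_def)
  qed
  hence "(\<Sum>k\<le>p + 2 * t. a k) = (\<Sum>k\<le>p + 2 * t. - a k)"
    by (intro sum.reindex_bij_witness[of _ "\<lambda>k. p + 2 * t - k" "\<lambda>k. p + 2 * t - k"]) auto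
  hence "(\<Sum>k\<le>p + 2 * t. a k) = 0"
    by (simp add: sum_negf)
  hence "int p * residue_sum p 0 (int t) (g * (1 - monom 1 1) ^ (2 * t)) = 0"
    unfolding mult_residue_sum_first_order[OF h p0] a_def .
  thus ?thesis using p0 by simp
qed

text \<open>Neighbours in row \<open>p - 1\<close> of Pascal's triangle add up to an inner entry of
  row \<open>p\<close>, a multiple of \<open>p\<close>.\<close>

lemma choose_pred_prime_cong:
  assumes "prime p" "j < p"
  shows "[int (p - 1 choose j) = (-1) ^ j] (mod int p)"
  using assms(2)
proof (induction j)
  case 0
  thus ?case by simp
next
  case (Suc j)
  have "p choose Suc j = (p - 1 choose j) + (p - 1 choose Suc j)"
    using prime_gt_0_nat[OF assms(1)] by (cases p) auto
  moreover have "int p dvd int (p choose Suc j)"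
    using prime_dvd_choose[OF assms(1), of "Suc j"] Suc.prems by (simp only: of_nat_dvd_iff)
  ultimately have "[int (p - 1 choose j) + int (p - 1 choose Suc j) = 0] (mod int p)"
    by (simp only: of_nat_add cong_0_iff)
  hence "[int (p - 1 choose j) + int (p - 1 choose Suc j) - int (p - 1 choose j) = 0 - (-1) ^ j] (mod int p)"
    using Suc by (intro cong_diff) auto
  thus ?case by simp
qed

lemma choose_prime_add_cong:
  assumes "prime p" "s < p"
  shows "[int (p + s choose s) = 1] (mod int p)"
  using assms(2)
proof (induction s)
  case 0
  thus ?case by simp
next
  case (Suc s)
  have "Suc s * (p + Suc s choose Suc s) = (p + Suc s) * (p + s choose s)"
    using Suc_times_binomial_eq[of "p + s" s] by (simp only: add_Suc_right mult.commute)
  hence "int (Suc s) * int (p + Suc s choose Suc s) = (int p + int (Suc s)) * int (p + s choose s)"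
    by (metis of_nat_mult of_nat_add)
  also have "[\<dots> = (0 + int (Suc s)) * 1] (mod int p)"
    using Suc by (intro cong_mult cong_add) (auto simp: cong_0_iff)
  finally have "[int (Suc s) * int (p + Suc s choose Suc s) = int (Suc s) * 1] (mod int p)"
    by simp
  moreover have "coprime (int (Suc s)) (int p)"
    using assms(1) Suc.prems
    by (metis coprime_commute coprime_int_iff nat_dvd_not_less prime_imp_coprime zero_less_Suc)
  ultimately show ?case by (simp only: cong_mult_lcancel)
qed

text \<open>Since \<open>s < t < p\<close>, the only \<open>k \<le> p + s\<close> congruent to
  \<open>t\<close> is \<open>t\<close> itself. The multiplier is the denominator of the final
  formula; it makes the factor \<open>p\<close> of \<open>p + s choose t\<close> explicit.\<close>

lemma residue_sum_first_order_less:
  assumes h: "(1 - monom 1 1) ^ p = (1 - monom 1 p) + of_nat p * (g :: int poly)"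
    and p: "prime p" and st: "s < t" "t < p"
  shows "[int (t * (t - 1 choose s)) * residue_sum p 0 (int t) (g * (1 - monom 1 1) ^ s) = - ((-1) ^ s)] (mod int p)"
proof -
  have p0: "p > 0" using p by (rule prime_gt_0_nat)
  have "int p dvd int k - int t \<longleftrightarrow> k = t" if "k \<le> p + s" for k
  proof
    assume "int p dvd int k - int t"
    then obtain c where c: "int k - int t = int p * c" by blast
    have "int p * c < int p * 1" "int p * (-1) < int p * c" 
      unfolding c[symmetric] using that st by simp_all
    hence "c = 0" using p0 by (simp only: mult_less_cancel_left) auto
    thus "k = t" using c by simp
  qed simp
  hence "int p * residue_sum p 0 (int t) (g * (1 - monom 1 1) ^ s) =
      (\<Sum>k\<le>p + s. if k = t then (-1) ^ t * int (p + s choose t) else 0)"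
    unfolding mult_residue_sum_first_order[OF h p0] residue_binomial_0
    by (intro sum.cong refl) auto
  hence *: "int p * residue_sum p 0 (int t) (g * (1 - monom 1 1) ^ s) = (-1) ^ t * int (p + s choose t)"
    using st by simp
  have tt: "t * (t - 1 choose s) = Suc s * (t choose Suc s)"
    using st by (simp only: times_binomial_minus1_eq diff_Suc_1 zero_less_Suc)
  \<comment> \<open>Regrouping by \<open>choose_mult\<close> leaves
    \<open>p + s choose Suc s\<close>, from which absorption extracts \<open>p\<close>, and two
    binomial coefficients known modulo \<open>p\<close>.\<close>
  have "t * (t - 1 choose s) * (p + s choose t) = Suc s * ((p + s choose t) * (t choose Suc s))"
    unfolding tt by (simp only: ac_simps)
  also have "(p + s choose t) * (t choose Suc s) =
      (p + s choose Suc s) * (p + s - Suc s choose (t - Suc s))"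
    using st by (intro choose_mult) auto
  also have "Suc s * \<dots> = (Suc s * (p + s choose Suc s)) * (p - 1 choose (t - Suc s))"
    by (simp only: mult.assoc Suc_eq_plus1 diff_add_inverse2 add_diff_cancel_right diff_diff_left add.commute[of s])
  also have "Suc s * (p + s choose Suc s) = p * (p + s choose s)"
    using binomial_absorption[of s "p + s"] binomial_absorb_comp[of "p + s" s] by simp
  finally have "t * (t - 1 choose s) * (p + s choose t) =
      p * (p + s choose s) * (p - 1 choose (t - Suc s))" .
  hence "int (t * (t - 1 choose s)) * int (p + s choose t) =
      int p * (int (p + s choose s) * int (p - 1 choose (t - Suc s)))"
    by (metis mult.assoc of_nat_mult)
  hence "int p * (int (t * (t - 1 choose s)) * residue_sum p 0 (int t) (g * (1 - monom 1 1) ^ s)) =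
      int p * ((-1) ^ t * (int (p + s choose s) * int (p - 1 choose (t - Suc s))))"
    using * by (simp only: mult.left_commute[of "int p"]) (simp only: ac_simps)
  hence "int (t * (t - 1 choose s)) * residue_sum p 0 (int t) (g * (1 - monom 1 1) ^ s) =
      (-1) ^ t * (int (p + s choose s) * int (p - 1 choose (t - Suc s)))"
    using p0 by (simp only: mult_cancel_left) simp
  also have "[\<dots> = (-1) ^ t * (1 * (-1) ^ (t - Suc s))] (mod int p)"
    using st by (intro cong_mult choose_prime_add_cong choose_pred_prime_cong p cong_refl) auto
  also have "(-1) ^ t * (1 * (-1) ^ (t - Suc s)) = - ((-1 :: int) ^ s)"
    using st by (auto simp: minus_one_power_iff)
  finally show ?thesis .
qed

section \<open>The two congruences for unnormalized sums\<close>

text \<open>Each alternative in \<open>cond\<close> makes the first order term vanish modulo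
  \<open>p ^ (e + 1)\<close>, so that only the zeroth order term survives.\<close>

lemma residue_sum_lucas:
  assumes p: "prime p" and n: "(e + l) * (p - 1) + l + 1 \<le> n" and st: "s < p" "t < p"
    and cond: "p dvd n \<or> s = p - 1 \<or> (e + l) * (p - 1) + l + 1 < n \<or> (s = 2 * t \<and> p \<noteq> 2)"
  shows "[residue_sum (p * p) l (int p * r + int t) ((1 - monom 1 1) ^ (p * n + s)) =
     (-1) ^ t * int (s choose t) * residue_sum p l r ((1 - monom 1 1) ^ n)] (mod int p ^ (e + 1))"
proof -
  have p2: "p \<ge> 2" using p by (rule prime_ge_2_nat)
  hence p0: "p > 0" by simp
  define v :: "int poly" where "v = 1 - monom 1 1"
  define W :: "int poly" where "W = 1 - monom 1 p"
  obtain h where h: "v ^ p = W + of_nat p * (v * (v * h - 1))"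
    using one_minus_monom_power_prime[OF p, of 1] by (auto simp: v_def W_def)
  define g where "g = v * (v * h - 1)"
  define R where "R = int p * r + int t"
  define T where "T = residue_sum (p * p) l R (W ^ (n - 1) * (g * v ^ s))"
  \<comment> \<open>One factor \<open>W\<close> is missing from the bound, but the explicit
    \<open>p\<close> makes up for it: for \<open>e > 1\<close> only \<open>e - 1\<close> powers are
    still required.\<close>
  have low: "int p ^ e dvd int p * residue_sum (p * p) l R (W ^ (n - 1) * f)" for f
  proof -
    have "int p ^ e dvd int p ^ 1 * residue_sum (p * p) l R (W ^ (n - 1) * f)"
      unfolding W_def
    proof (rule residue_sum_prime_power_mult_dvd[OF p p0])
      assume "1 < e"
      then obtain e' where e': "e = Suc e'" by (cases e) auto
      show "(e - 1 + l) * (p - 1) + l + 1 \<le> n - 1"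
        using n p2 unfolding e' by simp
    qed
    thus ?thesis by simp
  qed
  have less: "int p ^ (e + 1) dvd int n * int p * T" if "(e + l) * (p - 1) + l + 1 < n"
  proof -
    have "(e + l) * (p - 1) + l + 1 \<le> n - 1" using that by simp
    hence "int p ^ e dvd T"
      unfolding T_def W_def by (rule residue_sum_dvd[OF p p0])
    thus ?thesis by (simp add: mult.assoc)
  qed
  have "int p ^ (e + 1) dvd int n * int p * T"
    using cond
  proof (elim disjE conjE)
    assume "p dvd n"
    hence "int p * int p ^ e dvd int n * (int p * T)"
      unfolding T_def by (intro mult_dvd_mono low) simp
    thus ?thesis by (simp add: mult.assoc)
  next
    assume s: "s = p - 1"
    \<comment> \<open>The factor \<open>v\<close> of \<open>g\<close> completes \<open>v ^ s\<close>
      to a \<open>p\<close>-th power, which returns the missing \<open>W\<close> or else a further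
      \<open>p\<close>.\<close>
    have "v * v ^ s = W + of_nat p * g"
      using h s p0 by (simp add: g_def flip: power_Suc)
    hence gs: "g * v ^ s = (W + of_nat p * g) * (v * h - 1)"
      unfolding g_def by (metis mult.assoc mult.commute)
    have "W ^ (n - 1) * (g * v ^ s) =
        W ^ Suc (n - 1) * (v * h - 1) + of_nat p * (W ^ (n - 1) * (g * (v * h - 1)))"
      unfolding gs by (simp add: algebra_simps)
    moreover have "Suc (n - 1) = n" using n by simp
    ultimately have "T = residue_sum (p * p) l R (W ^ n * (v * h - 1)) +
        int p * residue_sum (p * p) l R (W ^ (n - 1) * (g * (v * h - 1)))"
      unfolding T_def by (simp only: residue_sum_add residue_sum_of_nat_mult)
    moreover have "int p ^ e dvd residue_sum (p * p) l R (W ^ n * (v * h - 1))"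
      unfolding W_def by (rule residue_sum_dvd[OF p p0 n])
    ultimately have "int p ^ e dvd T"
      using low by (simp add: dvd_add)
    thus ?thesis by (simp add: mult.assoc)
  next
    assume "(e + l) * (p - 1) + l + 1 < n"
    thus ?thesis by (rule less)
  next
    assume s: "s = 2 * t" and "p \<noteq> 2"
    have "odd p" using p \<open>p \<noteq> 2\<close> by (metis prime_odd_nat p2 le_neq_implies_less)
    hence c0: "residue_sum p 0 (int t) (g * v ^ s) = 0"
      using h unfolding s g_def v_def W_def by (intro residue_sum_first_order_symmetric)
    \<comment> \<open>In the critical case with \<open>e > 0\<close>, \<open>n - 1\<close> is the
      exponent in \<open>residue_sum_cong\<close>, whose leading value contains the sum that
      vanishes by \<open>c0\<close>.\<close>
    consider "(e + l) * (p - 1) + l + 1 < n" | "e = 0" |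
        k where "e = k + 1" "n - 1 = l + (l + k + 1) * (p - 1)"
      using n by (cases e) (auto simp: le_less add_ac)
    thus ?thesis
    proof cases
      case (3 k)
      hence "[T = 0] (mod int p ^ e)"
        using residue_sum_cong[OF p p0, of l R k "g * v ^ s"]
        by (simp add: T_def W_def R_def residue_sum_period c0)
      thus ?thesis by (simp add: cong_0_iff mult.assoc)
    qed (use less in simp_all)
  qed
  hence "[int n * int p * T = 0] (mod int p ^ (e + 1))"
    by (simp only: cong_0_iff)
  hence "[residue_sum (p * p) l R (v ^ s * W ^ n) + int n * int p * T =
      residue_sum (p * p) l R (v ^ s * W ^ n) + 0] (mod int p ^ (e + 1))"
    by (intro cong_add cong_refl)
  with residue_sum_expand_first_order[OF p n h[unfolded v_def W_def], of R s]
  have "[residue_sum (p * p) l R (v ^ (p * n + s)) = residue_sum (p * p) l R (v ^ s * W ^ n)] (mod int p ^ (e + 1))"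
    unfolding T_def g_def v_def W_def by (simp only: add_0_right) (rule cong_trans)
  thus ?thesis
    unfolding R_def v_def W_def residue_sum_main_term[OF p0 st] .
qed

text \<open>As \<open>s < t\<close>, the zeroth order term is 0 and the first order term decides.
  Multiplying by the denominator keeps the congruence in the integers.\<close>

lemma residue_sum_less:
  assumes p: "prime p" and n: "n = (e + l) * (p - 1) + l + 1" and st: "s < t" "t < p" and e: "e > 0"
  shows "[int (t * (t - 1 choose s)) *
      residue_sum (p * p) l (int p * r + int t) ((1 - monom 1 1) ^ (p * n + s)) =
     int p ^ e * ((-1) ^ (s + (e + l)) * int n * int (e + l - 1 choose l))] (mod int p ^ (e + 1))"
proof -
  have p0: "p > 0" using p by (rule prime_gt_0_nat)
  define v :: "int poly" where "v = 1 - monom 1 1"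
  define W :: "int poly" where "W = 1 - monom 1 p"
  obtain h where h: "v ^ p = W + of_nat p * (v * (v * h - 1))"
    using one_minus_monom_power_prime[OF p, of 1] by (auto simp: v_def W_def)
  define g where "g = v * (v * h - 1)"
  define R where "R = int p * r + int t"
  define T where "T = residue_sum (p * p) l R (W ^ (n - 1) * (g * v ^ s))"
  define c where "c = residue_sum p 0 (int t) (g * v ^ s)"
  define d where "d = int (t * (t - 1 choose s))"
  obtain k where k: "e = k + 1" using e by (cases e) auto
  have "[residue_sum (p * p) l R (v ^ (p * n + s)) =
      residue_sum (p * p) l R (v ^ s * W ^ n) + int n * int p * T] (mod int p ^ (e + 1))"
    unfolding T_def g_def v_def W_def
    by (rule residue_sum_expand_first_order[OF p _ h[unfolded v_def W_def]]) (simp add: n)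
  moreover have "residue_sum (p * p) l R (v ^ s * W ^ n) = 0"
    using st residue_sum_main_term[OF p0, of s t l r n] by (simp add: R_def v_def W_def)
  ultimately have X: "[d * residue_sum (p * p) l R (v ^ (p * n + s)) = d * (int n * int p * T)] (mod int p ^ (e + 1))"
    by (intro cong_scalar_left) simp
  have "n - 1 = l + (l + k + 1) * (p - 1)"
    by (simp add: n k ac_simps)
  hence "[T = (-1) ^ (l + k) * int (l + k choose l) * int p ^ k * c] (mod int p ^ e)"
    using residue_sum_cong[OF p p0, of l R k "g * v ^ s"]
    by (simp add: T_def W_def R_def residue_sum_period c_def k)
  hence "[int p * T = int p * ((-1) ^ (l + k) * int (l + k choose l) * int p ^ k * c)] (mod int p * int p ^ e)"
    by (rule cong_cmult_leftI)
  hence "[d * int n * (int p * T) = d * int n * (int p * ((-1) ^ (l + k) * int (l + k choose l) * int p ^ k * c))]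
      (mod int p ^ (e + 1))"
    unfolding Suc_eq_plus1[symmetric] power_Suc by (rule cong_scalar_left)
  also have "d * int n * (int p * ((-1) ^ (l + k) * int (l + k choose l) * int p ^ k * c)) =
      (-1) ^ (l + k) * int n * int (l + k choose l) * (int p ^ e * (d * c))"
    by (simp add: k ac_simps)
  also have "[\<dots> = (-1) ^ (l + k) * int n * int (l + k choose l) * (int p ^ e * (- ((-1) ^ s)))] (mod int p ^ (e + 1))"
  proof (rule cong_scalar_left)
    have "[d * c = - ((-1) ^ s)] (mod int p)"
      using h st unfolding d_def c_def g_def v_def W_def
      by (intro residue_sum_first_order_less[OF _ p])
    hence "[int p ^ e * (d * c) = int p ^ e * (- ((-1) ^ s))] (mod int p ^ e * int p)"
      by (rule cong_cmult_leftI)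
    thus "[int p ^ e * (d * c) = int p ^ e * (- ((-1) ^ s))] (mod int p ^ (e + 1))"
      by (simp add: mult.commute)
  qed
  also have "(-1) ^ (l + k) * int n * int (l + k choose l) * (int p ^ e * (- ((-1) ^ s))) =
      int p ^ e * ((-1) ^ (s + (e + l)) * int n * int (e + l - 1 choose l))"
    by (simp add: k power_add ac_simps)
  finally have "[d * (int n * int p * T) =
      int p ^ e * ((-1) ^ (s + (e + l)) * int n * int (e + l - 1 choose l))] (mod int p ^ (e + 1))"
    by (simp only: mult.assoc)
  with X show ?thesis unfolding d_def R_def v_def by (rule cong_trans)
qed

text \<open>For \<open>e = 0\<close> the factor \<open>p\<close> of the first order term already
  suffices.\<close>

lemma residue_sum_less_0:
  assumes p: "prime p" and n: "l * (p - 1) + l + 1 \<le> n" and st: "s < t" "t < p"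
  shows "[residue_sum (p * p) l (int p * r + int t) ((1 - monom 1 1) ^ (p * n + s)) = 0] (mod int p)"
proof -
  have p0: "p > 0" using p by (rule prime_gt_0_nat)
  obtain h :: "int poly" where h: "(1 - monom 1 1) ^ p =
      (1 - monom 1 p) + of_nat p * ((1 - monom 1 1) * ((1 - monom 1 1) * h - 1))"
    using one_minus_monom_power_prime[OF p, of 1] by auto
  have "residue_sum (p * p) l (int p * r + int t) ((1 - monom 1 1) ^ s * (1 - monom 1 p) ^ n) = 0"
    using st residue_sum_main_term[OF p0, of s t l r n] by simp
  thus ?thesis
    using residue_sum_expand_first_order[OF p _ h, of 0 l n "int p * r + int t" s] n
    by (simp add: cong_0_iff cong_dvd_iff)
qed

section \<open>Normalization and \<open>p\<close>-integral congruences\<close>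

lemma psi_coeff_eq_residue_sum:
  assumes "p > 0"
  shows "psi_coeff p b l n r =
    of_nat p powi (- \<lfloor>(of_nat n - of_nat p ^ (b - 1) - of_nat l * of_nat p ^ b) /
      (of_nat (totient (p ^ b)) :: rat)\<rfloor>) * of_int (residue_sum (p ^ b) l r ((1 - monom 1 1) ^ n))"
proof -
  have "of_int (residue_sum (p ^ b) l r ((1 - monom 1 1) ^ n)) =
      (\<Sum>k\<le>n. (-1) ^ k * of_nat (n choose k) * of_int (residue_binomial (p ^ b) l (int k - r)) :: rat)"
    by (simp add: residue_sum_binomial_power)
  also have "\<dots> = (\<Sum>k\<le>n. if [int k = r] (mod int p ^ b) then
      (-1) ^ k * of_nat (n choose k) * ((of_int (int k - r) / of_nat p ^ b) gchoose l) else 0)"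
    by (intro sum.cong refl)
       (simp add: residue_binomial_def cong_iff_dvd_diff of_int_int_gbinomial of_int_div)
  also have "\<dots> = (\<Sum>k | k \<le> n \<and> [int k = r] (mod int p ^ b).
      (-1) ^ k * of_nat (n choose k) * ((of_int (int k - r) / of_nat p ^ b) gchoose l))"
    by (subst sum.inter_filter[symmetric]) simp_all
  finally show ?thesis by (simp only: psi_coeff_def)
qed

lemma psi_coeff_1_eq:
  assumes p: "prime p"
  shows "psi_coeff p 1 l n r =
    of_nat p powi (- ((int n - int l - 1) div (int p - 1) - int l)) *
      of_int (residue_sum p l r ((1 - monom 1 1) ^ n))"
proof -
  have p2: "p \<ge> 2" using p by (rule prime_ge_2_nat)
  have "(of_nat n - of_nat p ^ (1 - 1) - of_nat l * of_nat p ^ 1) / (of_nat (totient (p ^ 1)) :: rat) =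
      of_int ((int n - int l - 1) + (- int l) * (int p - 1)) / of_int (int p - 1)"
    using p2 by (simp add: totient_prime[OF p] of_nat_diff algebra_simps)
  hence "\<lfloor>(of_nat n - of_nat p ^ (1 - 1) - of_nat l * of_nat p ^ 1) / (of_nat (totient (p ^ 1)) :: rat)\<rfloor> =
      ((int n - int l - 1) + (- int l) * (int p - 1)) div (int p - 1)"
    by (simp only: floor_divide_of_int_eq)
  also have "\<dots> = (int n - int l - 1) div (int p - 1) - int l"
    using p2 by (subst div_mult_self1) auto
  finally show ?thesis
    using p2 by (simp add: psi_coeff_eq_residue_sum)
qed

text \<open>Because \<open>s < p\<close>, the contribution of \<open>s\<close> disappears in the
  floor. The normalizing power is therefore the same as in \<open>psi_coeff_1_eq\<close>, and
  unnormalized sums can be compared directly.\<close>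

lemma psi_coeff_2_eq:
  assumes p: "prime p" and s: "s < p"
  shows "psi_coeff p 2 l (p * n + s) r =
    of_nat p powi (- ((int n - int l - 1) div (int p - 1) - int l)) *
      of_int (residue_sum (p * p) l r ((1 - monom 1 1) ^ (p * n + s)))"
proof -
  have p2: "p \<ge> 2" using p by (rule prime_ge_2_nat)
  define a where "a = (int n - int l - 1) + (- int l) * (int p - 1)"
  have "totient (p ^ 2) = p * (p - 1)"
    using totient_prime_power[OF p, of 2] by simp
  hence "(of_nat (p * n + s) - of_nat p ^ (2 - 1) - of_nat l * of_nat p ^ 2) / (of_nat (totient (p ^ 2)) :: rat) =
      of_int (int s + int p * a) / of_int (int p * (int p - 1))"
    using p2 by (simp add: a_def of_nat_diff algebra_simps power2_eq_square)
  hence "\<lfloor>(of_nat (p * n + s) - of_nat p ^ (2 - 1) - of_nat l * of_nat p ^ 2) / (of_nat (totient (p ^ 2)) :: rat)\<rfloor> =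
      (int s + int p * a) div (int p * (int p - 1))"
    by (simp only: floor_divide_of_int_eq)
  also have "\<dots> = (int s + int p * a) div int p div (int p - 1)"
    using p2 by (intro zdiv_zmult2_eq) simp
  also have "(int s + int p * a) div int p = a"
    using s by simp
  also have "a div (int p - 1) = (int n - int l - 1) div (int p - 1) - int l"
    unfolding a_def using p2 by (subst div_mult_self1) auto
  finally show ?thesis
    using p2 psi_coeff_eq_residue_sum[of p 2 l "p * n + s" r] by (simp add: power2_eq_square)
qed

lemma p_cong_of_int:
  assumes "prime p" and "\<not> int p dvd d" and "[d * a = b] (mod int p)"
  shows "p_cong p (of_int a) (of_int b / of_int d)"
proof -
  obtain z where z: "d * a - b = int p * z"
    using assms(3) by (auto simp: cong_iff_dvd_diff)
  have d0: "d \<noteq> 0" using assms(2) by auto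
  have "of_int a - of_int b / of_int d = (of_int (d * a - b) / of_int d :: rat)"
    using d0 by (simp add: field_simps)
  also have "\<dots> = of_nat p * (of_int z / of_int d)"
    unfolding z by simp
  finally have "of_int a - of_int b / of_int d = (of_nat p * (of_int z / of_int d) :: rat)" .
  moreover have "p_integral p (of_int a)"
    unfolding p_integral_def using prime_gt_1_nat[OF assms(1)] 
    by (intro exI[of _ a] exI[of _ 1]) simp
  moreover have "p_integral p (of_int x / of_int d)" for x
    using assms(2) unfolding p_integral_def by blast
  ultimately show ?thesis unfolding p_cong_def by blast
qed

text \<open>As \<open>d\<close> is prime to \<open>p\<close>, the congruence itself forces
  \<open>p ^ e\<close> to divide \<open>X\<close>, which gives integrality; then
  \<open>p ^ e\<close> is cancelled.\<close>

lemma p_cong_powi: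
  assumes p: "prime p" and d: "\<not> int p dvd d"
    and X: "[d * X = int p ^ e * b] (mod int p ^ (e + 1))"
  shows "p_cong p (of_nat p powi (- int e) * of_int X) (of_int b / of_int d)"
proof -
  have p0: "p > 0" using p by (rule prime_gt_0_nat)
  have "int p ^ e dvd d * X"
    using cong_dvd_modulus[OF X, of "int p ^ e"] by (simp add: cong_dvd_iff)
  moreover have "coprime (int p ^ e) d"
    using p d by (intro coprime_power_left_iff[THEN iffD2] disjI1 prime_imp_coprime) auto
  ultimately have "int p ^ e dvd X"
    by (simp add: coprime_dvd_mult_right_iff)
  then obtain a where a: "X = int p ^ e * a" by blast
  have "int p ^ e * int p dvd int p ^ e * (d * a - b)"
    using X by (simp add: a cong_iff_dvd_diff algebra_simps)
  hence "[d * a = b] (mod int p)"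
    using p0 by (simp add: cong_iff_dvd_diff)
  hence "p_cong p (of_int a) (of_int b / of_int d)"
    by (rule p_cong_of_int[OF p d])
  moreover have "of_nat p powi (- int e) * of_int X = (of_int a :: rat)"
    using p0 by (simp add: a power_int_minus field_simps)
  ultimately show ?thesis by simp
qed

lemma prime_not_dvd_choose:
  assumes "prime p" "n < p" "k \<le> n"
  shows "\<not> p dvd (n choose k)"
  using assms binomial_fact_lemma[of k n] prime_dvd_fact_iff[of p n]
  by (metis dvd_mult leD)

section \<open>Assembly by the sign of the normalizing exponent\<close>

theorem theorem1p2:
  fixes p l n s t :: nat and r :: int
  assumes "prime p" and "s \<in> {0..p - 1}" and "t \<in> {0..p - 1}"
  shows
    "(p dvd n \<or> \<not> (int p - 1) dvd (int n - int l - 1) \<or> s = p - 1 \<or> (s = 2 * t \<and> p \<noteq> 2) \<longrightarrow>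
        p_cong p
          (psi_coeff p 2 l (p * n + s) (int p * r + int t))
          ((- 1) ^ t * of_nat (s choose t) * psi_coeff p 1 l n r))
     \<and>
     (\<not> p dvd n \<and> (int p - 1) dvd (int n - int l - 1) \<and> s < t \<and> t \<le> p - 1 \<longrightarrow>
        p_cong p
          (psi_coeff p 2 l (p * n + s) (int p * r + int t))
          (if n > l + 1
           then (- 1) ^ (s + (n - l - 1) div (p - 1)) * (of_nat n / of_nat t)
                  * of_nat (((n - l - 1) div (p - 1) - 1) choose l) / of_nat ((t - 1) choose s)
           else 0))"
proof -
  note p = assms(1)
  have p2: "p \<ge> 2" using p by (rule prime_ge_2_nat)
  have st: "s < p" "t < p" using assms p2 by auto
  have not_dvd_1: "\<not> int p dvd 1" using p2 by simp
  define X where "X = residue_sum (p * p) l (int p * r + int t) ((1 - monom 1 1) ^ (p * n + s))"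
  define Y where "Y = residue_sum p l r ((1 - monom 1 1) ^ n)"
  define m where "m = (int n - int l - 1) div (int p - 1)"
  note psi2 = psi_coeff_2_eq[OF p st(1), of l n "int p * r + int t", folded X_def m_def]
  note psi1 = psi_coeff_1_eq[OF p, of l n r, folded Y_def m_def]
  have m: "int n - int l - 1 = m * (int p - 1) + (int n - int l - 1) mod (int p - 1)"
    unfolding m_def by (rule div_mult_mod_eq[symmetric])
  show ?thesis
  proof (cases "m < int l")
    \<comment> \<open>The normalizing exponent is positive, so both coefficients are multiples of
      \<open>p\<close>. In the second claim the binomial coefficient vanishes, its upper argument
      being below \<open>l\<close>.\<close>
    case True
    then obtain j where j: "- (m - int l) = int (Suc j)"
      by (metis add.inverse_inverse neg_less_0_iff_less diff_less_0_iff_less zero_less_imp_eq_int gr0_conv_Suc)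
    have pw: "of_nat p powi int (Suc j) = (of_nat p * of_nat p ^ j :: rat)"
      by (simp only: power_int_of_nat power_Suc)
    have small: "p_cong p (psi_coeff p 2 l (p * n + s) (int p * r + int t)) (of_int (int p * Z))" for Z
      unfolding psi2 j pw using p_cong_of_int[OF p not_dvd_1, of "int p * (int p ^ j * X)" "int p * Z"]
      by (simp add: cong_iff_dvd_diff mult.assoc)
    show ?thesis
    proof (intro conjI impI)
      show "p_cong p (psi_coeff p 2 l (p * n + s) (int p * r + int t))
          ((- 1) ^ t * of_nat (s choose t) * psi_coeff p 1 l n r)"
        using small[of "(-1) ^ t * int (s choose t) * int p ^ j * Y"] unfolding psi1 j pw
        by (simp add: ac_simps)
    next
      have "(n - l - 1) div (p - 1) - 1 < l" if "n > l + 1" "(int p - 1) dvd (int n - int l - 1)"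
      proof -
        have *: "int n - int l - 1 = int (n - l - 1)" "int p - 1 = int (p - 1)"
          using that p2 by auto
        have "m = int ((n - l - 1) div (p - 1))"
          unfolding m_def * by (rule zdiv_int[symmetric])
        moreover have "(p - 1) dvd (n - l - 1)"
          using that(2) unfolding * by (simp only: of_nat_dvd_iff)
        hence "(n - l - 1) div (p - 1) \<noteq> 0"
          using that p2 by (auto simp: div_eq_0_iff dest: dvd_imp_le)
        ultimately show ?thesis using True by simp
      qed
      thus "p_cong p (psi_coeff p 2 l (p * n + s) (int p * r + int t))
          (if n > l + 1
           then (- 1) ^ (s + (n - l - 1) div (p - 1)) * (of_nat n / of_nat t)
                  * of_nat (((n - l - 1) div (p - 1) - 1) choose l) / of_nat ((t - 1) choose s)
           else 0)" if "\<not> p dvd n \<and> (int p - 1) dvd (int n - int l - 1) \<and> s < t \<and> t \<le> p - 1"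
        using small[of 0] that by (simp add: binomial_eq_0)
    qed
  next
    case False
    \<comment> \<open>Here \<open>p ^ e\<close> is divided out and \<open>i\<close> measures the
      slack in \<open>n = (e + l) * (p - 1) + l + 1 + i\<close>; the critical case
      \<open>i = 0\<close> is the divisibility condition of the theorem.\<close>
    define e where "e = nat (m - int l)"
    define i where "i = nat ((int n - int l - 1) mod (int p - 1))"
    have e: "m - int l = int e" using False by (simp add: e_def)
    have "m = int (e + l)" using e by simp
    moreover have mod_i: "(int n - int l - 1) mod (int p - 1) = int i"
      using p2 by (simp add: i_def)
    ultimately have "int n - int l - 1 = int (e + l) * (int p - 1) + int i"
      using m by (simp only:)
    moreover have "int p - 1 = int (p - 1)" using p2 by simp
    ultimately have "int n - int l - 1 = int (e + l) * int (p - 1) + int i"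
      by (simp only:)
    hence "int n = int ((e + l) * (p - 1) + l + 1 + i)"
      by (simp only: of_nat_mult[symmetric])
    hence n: "n = (e + l) * (p - 1) + l + 1 + i"
      by (simp only: of_nat_eq_iff)
    have i: "i = 0 \<longleftrightarrow> (int p - 1) dvd (int n - int l - 1)"
      by (simp only: dvd_eq_mod_eq_0 mod_i of_nat_eq_0_iff)
    show ?thesis
    proof (intro conjI impI)
      assume cond: "p dvd n \<or> \<not> (int p - 1) dvd (int n - int l - 1) \<or> s = p - 1 \<or> (s = 2 * t \<and> p \<noteq> 2)"
      \<comment> \<open>Taking \<open>q = 1\<close> gives integrality of the coefficient on the
        right.\<close>
      have "int p ^ e dvd residue_sum (p * 1) l r ((1 - monom 1 1) ^ n * 1)"
        by (rule residue_sum_dvd[OF p]) (simp_all add: n)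
      then obtain y where y: "Y = int p ^ e * y"
        by (auto simp: Y_def)
      have "(e + l) * (p - 1) + l + 1 < n" if "i \<noteq> 0"
        using that by (subst n) simp
      with cond i have "p dvd n \<or> s = p - 1 \<or> (e + l) * (p - 1) + l + 1 < n \<or> (s = 2 * t \<and> p \<noteq> 2)"
        by blast
      moreover have "(e + l) * (p - 1) + l + 1 \<le> n" by (subst n) simp
      ultimately have "[X = (-1) ^ t * int (s choose t) * Y] (mod int p ^ (e + 1))"
        unfolding X_def Y_def by (intro residue_sum_lucas[OF p _ st])
      hence "[1 * X = int p ^ e * ((-1) ^ t * int (s choose t) * y)] (mod int p ^ (e + 1))"
        by (simp add: y ac_simps)
      note p_cong_powi[OF p not_dvd_1 this]
      moreover have "of_nat p powi (- int e) * of_int Y = (of_int y :: rat)"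
        using p2 by (simp add: y power_int_minus field_simps)
      ultimately show "p_cong p (psi_coeff p 2 l (p * n + s) (int p * r + int t))
          ((- 1) ^ t * of_nat (s choose t) * psi_coeff p 1 l n r)"
        unfolding psi1 psi2 e by simp
    next
      assume B: "\<not> p dvd n \<and> (int p - 1) dvd (int n - int l - 1) \<and> s < t \<and> t \<le> p - 1"
      hence n': "n = (e + l) * (p - 1) + l + 1"
        using n i by simp
      have quot: "(n - l - 1) div (p - 1) = e + l"
        using p2 by (simp add: n')
      show "p_cong p (psi_coeff p 2 l (p * n + s) (int p * r + int t))
          (if n > l + 1
           then (- 1) ^ (s + (n - l - 1) div (p - 1)) * (of_nat n / of_nat t)
                  * of_nat (((n - l - 1) div (p - 1) - 1) choose l) / of_nat ((t - 1) choose s)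
           else 0)"
      proof (cases "e = 0")
        \<comment> \<open>If \<open>l > 0\<close>, the formula contains
          \<open>l - 1 choose l\<close>, which is 0; if \<open>l = 0\<close>, then
          \<open>n = l + 1\<close> and the zero branch applies.\<close>
        case True
        have "[1 * X = int p ^ 0 * 0] (mod int p ^ (0 + 1))"
          using residue_sum_less_0[OF p _ _ st(2), of l n s r] B n' True by (simp add: X_def)
        note p_cong_powi[OF p not_dvd_1 this]
        moreover have "(e + l - 1 choose l) = 0" if "n > l + 1"
          using that n' True by (cases l) (auto intro: binomial_eq_0)
        ultimately show ?thesis
          unfolding psi2 e quot True by (simp del: binomial_eq_0_iff)
      next
        case False
        \<comment> \<open>The common denominator is prime to \<open>p\<close> because
          \<open>0 < t < p\<close> and \<open>s \<le> t - 1\<close>.\<close>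
        define d where "d = t * (t - 1 choose s)"
        have "\<not> p dvd (t - 1 choose s)"
          using st B by (intro prime_not_dvd_choose[OF p]) auto
        moreover have "\<not> p dvd t"
          using st B by (auto dest: dvd_imp_le)
        ultimately have "\<not> p dvd d"
          using p by (simp add: d_def prime_dvd_mult_iff)
        hence "\<not> int p dvd int d" by simp
        moreover have "[int d * X = int p ^ e * ((-1) ^ (s + (e + l)) * int n * int (e + l - 1 choose l))]
            (mod int p ^ (e + 1))"
          unfolding d_def X_def using residue_sum_less[OF p n' _ st(2)] B False by simp
        ultimately have "p_cong p (of_nat p powi (- int e) * of_int X)
            (of_int ((-1) ^ (s + (e + l)) * int n * int (e + l - 1 choose l)) / of_int (int d))"
          by (rule p_cong_powi[OF p])
        moreover have "n > l + 1" using n' False p2 by simp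
        ultimately show ?thesis unfolding psi2 e quot by (simp add: d_def)
      qed
    qed
  qed
qed

end
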